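(* Let $k\ge 1$ be an integer, let $G=(V,E,w)$ be a weighted graph, and let $C\subseteq E$ be a positive cut set whose deletion splits $G$ into exactly two connected components $G_1=(V_1,E_1,w_1)$ and $G_2=(V_2,E_2,w_2)$. If - $G[C]$ has at most $k$ vertices, or - $G[C]$ has at most $k-1$ edges, then splitting $G$ into $G_1,G_2$ by deleting $C$ is an optimality-preserving data separation for Max $k$-Cut, with reconstruction algorithm ReconstructSCS. That is, for every $k$-partition $p'$ of $V_1$ and every $k$-partition $p''$ of $V_2$, ReconstructSCS returns a $k$-partition $p$ of $V$ (and not an error), and if $p'$ and $p''$ are optimum Max $k$-Cut solutions for $G_1$ and $G_2$, respectively, then $p$ is an optimum Max $k$-Cut solution for $G$.
   Context: A weighted graph is a finite simple undirected graph with real edge weights. A cut set is an edge set of the form $\delta_G(S)=\{\{s,t\}\in E: s\in S, t\notin S\}$ for some $S\subseteq V$; it is positive if all its edges have positive weight. Here $C=\delta_G(V_1)=\delta_G(V_2)$ and $V=V_1\sqcup V_2$. $G[C]$ is the graph with edge set $C$ whose vertices are exactly the endpoints of edges in $C$. A $k$-partition of a set $M$ is a function $p:M\to\{1,\dots,k\}$. The weight of a $k$-partition of the vertices of a weighted graph is the sum of the weights of all edges whose endpoints have different colours; an optimum Max $k$-Cut solution is a $k$-partition of maximum weight. A data separation transforms a weighted graph $G$ into weighted graphs $G_1,\dots,G_i$ and provides a reconstruction algorithm that maps $k$-partitions of the vertex sets of $G_1,\dots,G_i$ to a $k$-partition of $V(G)$. It is optimality-preserving if the reconstruction maps any optimum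 solutions for $G_1,\dots,G_i$ to an optimum solution for $G$. For a bipartite graph $B=(X\sqcup Y,F)$ with bipartition $X,Y$, the bipartite complement with respect to $X,Y$ is the bipartite graph on $X\sqcup Y$ whose edges are all $\{x,y\}$ with $x\in X$, $y\in Y$, $\{x,y\}\notin F$. Algorithm ReconstructSCS$(G,C,p',p'',k)$: (1) Determine the two components with vertex sets $V_1,V_2$ of $G$ without $C$. (2) Build the colour relation graph $G_{CR}$ with vertex set $\{1,\dots,k\}\times\{L,R\}$ and edge set $\{\{(p'(x),L),(p''(y),R)\} : \{x,y\}\in C,\ x\in V_1,\ y\in V_2\}$. (3) Compute a maximum matching $M$ in the bipartite complement of $G_{CR}$ with respect to $\{(i,L): 1\le i\le k\}$ and $\{(i,R): 1\le i\le k\}$. (4) If $|M|<k$, return the error "reconstruction not possible". (5) Otherwise set $\pi(j)=i$ for every $\{(i,L),(j,R)\}\in M$, and return the $k$-partition $p$ of $V$ with $p(v)=p'(v)$ for $v\in V_1$ and $p(v)=\pi(p''(v))$ for $v\in V_2$. *)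

theory Defs
  imports Complex_Main
begin

section \<open>Finite simple graphs and weighted graphs\<close>

record 'a graph =
  verts :: "'a set"
  edges :: "'a set set"

text \<open>Only the values of \<open>weight\<close> on the edges are relevant.\<close>

record 'a wgraph = "'a graph" +
  weight :: "'a set \<Rightarrow> real"

definition simple_graph :: "('a, 'b) graph_scheme \<Rightarrow> bool" where
  "simple_graph G \<longleftrightarrow> finite (verts G) \<and> (\<forall>e\<in>edges G. e \<subseteq> verts G \<and> card e = 2)"

definition delete_edges :: "('a, 'b) graph_scheme \<Rightarrow> 'a set set \<Rightarrow> ('a, 'b) graph_scheme" where
  "delete_edges G C = G\<lparr>edges := edges G - C\<rparr>"

definition induced_subgraph :: "('a, 'b) graph_scheme \<Rightarrow> 'a set \<Rightarrow> ('a, 'b) graph_scheme" where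
  "induced_subgraph G S = G\<lparr>verts := S, edges := {e \<in> edges G. e \<subseteq> S}\<rparr>"

definition edge_subgraph :: "('a, 'b) graph_scheme \<Rightarrow> 'a set set \<Rightarrow> ('a, 'b) graph_scheme" where
  "edge_subgraph G C = G\<lparr>verts := \<Union>C, edges := C\<rparr>"

definition connected_rel :: "('a, 'b) graph_scheme \<Rightarrow> 'a rel" where
  "connected_rel G = {(x, y) \<in> verts G \<times> verts G. (x, y) \<in> {(u, v). {u, v} \<in> edges G}\<^sup>*}"

definition component_verts :: "('a, 'b) graph_scheme \<Rightarrow> 'a set set" where
  "component_verts G = verts G // connected_rel G"

definition components :: "('a, 'b) graph_scheme \<Rightarrow> ('a, 'b) graph_scheme set" where
  "components G = induced_subgraph G ` component_verts G"

section \<open>Cut sets\<close>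

definition cut :: "('a, 'b) graph_scheme \<Rightarrow> 'a set \<Rightarrow> 'a set set" where
  "cut G S = {{s, t} | s t. {s, t} \<in> edges G \<and> s \<in> S \<and> t \<notin> S}"

definition cut_set :: "('a, 'b) graph_scheme \<Rightarrow> 'a set set \<Rightarrow> bool" where
  "cut_set G C \<longleftrightarrow> (\<exists>S\<subseteq>verts G. C = cut G S)"

definition positive_cut_set :: "'a wgraph \<Rightarrow> 'a set set \<Rightarrow> bool" where
  "positive_cut_set G C \<longleftrightarrow> cut_set G C \<and> (\<forall>e\<in>C. weight G e > 0)"

section \<open>Max k-Cut\<close>

text \<open>A function \<open>A \<rightarrow> {1,\<dots>,k}\<close> is represented as a map, so that its domain \<open>A\<close> can be
  read off from it.\<close>

definition k_partition :: "nat \<Rightarrow> 'a set \<Rightarrow> ('a \<rightharpoonup> nat) \<Rightarrow> bool" where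
  "k_partition k A p \<longleftrightarrow> dom p = A \<and> ran p \<subseteq> {1..k}"

definition partition_weight :: "'a wgraph \<Rightarrow> ('a \<rightharpoonup> nat) \<Rightarrow> real" where
  "partition_weight G p = (\<Sum>e \<in> {e \<in> edges G. \<exists>x y. e = {x, y} \<and> p x \<noteq> p y}. weight G e)"

definition optimum_max_k_cut :: "nat \<Rightarrow> 'a wgraph \<Rightarrow> ('a \<rightharpoonup> nat) \<Rightarrow> bool" where
  "optimum_max_k_cut k G p \<longleftrightarrow> is_arg_max (partition_weight G) (k_partition k (verts G)) p"

section \<open>Data separations\<close>

datatype 'p outcome = Error | Return 'p

text \<open>A reconstruction algorithm may contain arbitrary choices. It is modelled by the set of
  outcomes of all its possible runs, and what is demanded of it must hold for every run. The
  \<open>n\<close>-th argument partition belongs to the \<open>n\<close>-th graph of the list \<open>Gs\<close>.\<close>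

type_synonym 'a reconstruction = "('a \<rightharpoonup> nat) list \<Rightarrow> ('a \<rightharpoonup> nat) outcome set"

definition data_separation ::
  "nat \<Rightarrow> 'a wgraph \<Rightarrow> 'a wgraph list \<Rightarrow> 'a reconstruction \<Rightarrow> bool" where
  "data_separation k G Gs rec \<longleftrightarrow>
     (\<forall>H\<in>set Gs. simple_graph H) \<and>
     (\<forall>ps. list_all2 (\<lambda>H. k_partition k (verts H)) Gs ps \<longrightarrow>
        rec ps \<noteq> {} \<and> (\<forall>r\<in>rec ps. \<exists>p. r = Return p \<and> k_partition k (verts G) p))"

definition optimality_preserving ::
  "nat \<Rightarrow> 'a wgraph \<Rightarrow> 'a wgraph list \<Rightarrow> 'a reconstruction \<Rightarrow> bool" where
  "optimality_preserving k G Gs rec \<longleftrightarrow>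
     (\<forall>ps. list_all2 (optimum_max_k_cut k) Gs ps \<longrightarrow>
        (\<forall>r\<in>rec ps. \<exists>p. r = Return p \<and> optimum_max_k_cut k G p))"

section \<open>Reconstruction for a split along a cut set\<close>

definition bipartite_complement :: "'a set \<Rightarrow> 'a set \<Rightarrow> 'a graph \<Rightarrow> 'a graph" where
  "bipartite_complement X Y B =
     \<lparr>verts = X \<union> Y, edges = {{x, y} | x y. x \<in> X \<and> y \<in> Y \<and> {x, y} \<notin> edges B}\<rparr>"

definition matching :: "('a, 'b) graph_scheme \<Rightarrow> 'a set set \<Rightarrow> bool" where
  "matching G M \<longleftrightarrow> M \<subseteq> edges G \<and> pairwise disjnt M"

definition maximum_matching :: "('a, 'b) graph_scheme \<Rightarrow> 'a set set \<Rightarrow> bool" where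
  "maximum_matching G M \<longleftrightarrow> is_arg_max card (matching G) M"

datatype side = L | R

definition colour_relation_graph ::
  "'a set set \<Rightarrow> 'a set \<Rightarrow> 'a set \<Rightarrow> ('a \<rightharpoonup> nat) \<Rightarrow> ('a \<rightharpoonup> nat) \<Rightarrow> nat \<Rightarrow> (nat \<times> side) graph" where
  "colour_relation_graph C V1 V2 p' p'' k =
     \<lparr>verts = {1..k} \<times> {L, R},
      edges = {{(i, L), (j, R)} | i j.
        \<exists>x\<in>V1. \<exists>y\<in>V2. {x, y} \<in> C \<and> p' x = Some i \<and> p'' y = Some j}\<rparr>"

definition matching_colour :: "(nat \<times> side) set set \<Rightarrow> nat \<Rightarrow> nat" where
  "matching_colour M j = (THE i. {(i, L), (j, R)} \<in> M)"

text \<open>The arbitrary choice in the algorithm is that of the maximum matching \<open>M\<close>. The domains of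
  \<open>p'\<close> and \<open>p''\<close> determine which of the two components is \<open>V1\<close> and which is \<open>V2\<close>; there is no run
  if the inputs do not fit together in this way.\<close>

definition reconstruct_SCS ::
  "('a, 'b) graph_scheme \<Rightarrow> 'a set set \<Rightarrow> ('a \<rightharpoonup> nat) \<Rightarrow> ('a \<rightharpoonup> nat) \<Rightarrow> nat
     \<Rightarrow> ('a \<rightharpoonup> nat) outcome set" where
  "reconstruct_SCS G C p' p'' k =
     {r. \<exists>V1 V2 M.
        V1 \<noteq> V2 \<and> component_verts (delete_edges G C) = {V1, V2} \<and>
        dom p' = V1 \<and> dom p'' = V2 \<and>
        maximum_matching
          (bipartite_complement ({1..k} \<times> {L}) ({1..k} \<times> {R})
             (colour_relation_graph C V1 V2 p' p'' k)) M \<and>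
        r = (if card M < k then Error
             else Return (\<lambda>v. if v \<in> V1 then p' v
                              else if v \<in> V2 then map_option (matching_colour M) (p'' v)
                              else None))}"

end

theory Submission
  imports Defs
begin

text \<open>A run of the algorithm succeeds iff some permutation \<open>\<pi>\<close> of the colours avoids every pair
  \<open>(p' x, p'' y)\<close> coming from an edge \<open>{x, y}\<close> of \<open>C\<close>. If \<open>C\<close> has fewer than \<open>k\<close> edges, each of
  them rules out exactly one of the \<open>k\<close> cyclic shifts, so a shift remains. If \<open>C\<close> has at most \<open>k\<close>
  end points, there is room to send the colours used on the \<open>V2\<close> side injectively to colours not
  used on the \<open>V1\<close> side. After recolouring by \<open>\<pi>\<close> all edges of \<open>C\<close> are cut; as they have positive
  weight, and permuting colours does not change the weight on \<open>G2\<close>, the result is optimal.\<close>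

section \<open>Permutations avoiding pairs\<close>

lemma mod_add_right_cancel_nat:
  fixes a b c m :: nat
  assumes "(a + c) mod m = (b + c) mod m"
  shows "a mod m = b mod m"
  using assms by (auto simp: nat_mod_eq_iff)

text \<open>A pair in \<open>F\<close> lies on the graph of at most one of the \<open>k\<close>
  cyclic shifts. If every shift hit \<open>F\<close>, choosing one hit per shift would inject
  \<open>k\<close> shifts into fewer than \<open>k\<close> pairs.\<close>

lemma ex_permutation_avoiding_pairs:
  assumes "finite F" and "card F < k"
  shows "\<exists>\<pi>. bij_betw \<pi> {1..k} {1..k} \<and> (\<forall>j\<in>{1..k}. (\<pi> j, j) \<notin> F)"
proof -
  \<comment> \<open>\<open>Suc\<close> moves the residues \<open>0..k-1\<close> to the colours
    \<open>1..k\<close>. On colours this is translation by \<open>s + 1\<close>, so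
    \<open>s < k\<close> runs through all cyclic shifts.\<close>
  define shift where "shift s j = Suc ((j + s) mod k)" for s j
  have "k > 0" using assms by simp
  have bij: "bij_betw (shift s) {1..k} {1..k}" for s
  proof -
    have "inj_on (shift s) {1..k}"
    proof (rule inj_onI)
      fix i j assume ij: "i \<in> {1..k}" "j \<in> {1..k}" "shift s i = shift s j"
      \<comment> \<open>Colour \<open>k\<close> has residue \<open>0\<close>, so the representatives
        \<open>i - 1 < k\<close> are used; for them congruence modulo \<open>k\<close> is
        equality.\<close>
      then have "((i - 1) + (s + 1)) mod k = ((j - 1) + (s + 1)) mod k"
        by (simp add: shift_def)
      then have "(i - 1) mod k = (j - 1) mod k"
        by (rule mod_add_right_cancel_nat)
      moreover have "i - 1 < k" "j - 1 < k" using ij by auto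
      ultimately have "i - 1 = j - 1" by (metis mod_less)
      then show "i = j" using ij(1,2) unfolding atLeastAtMost_iff by arith
    qed
    moreover have "shift s ` {1..k} \<subseteq> {1..k}"
      using \<open>k > 0\<close> by (auto simp: shift_def Suc_le_eq)
    ultimately show ?thesis
      by (simp add: bij_betw_def endo_inj_surj)
  qed
  have "\<exists>s<k. \<forall>j\<in>{1..k}. (shift s j, j) \<notin> F"
  proof (rule ccontr)
    assume "\<not> ?thesis"
    then obtain f where f: "\<And>s. s < k \<Longrightarrow> (shift s (f s), f s) \<in> F"
      by (metis)
    \<comment> \<open>The second component fixes the colour, and then the first determines
      \<open>s\<close> modulo \<open>k\<close>.\<close>
    have "inj_on (\<lambda>s. (shift s (f s), f s)) {..<k}"
    proof (rule inj_onI)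
      fix s t assume "s \<in> {..<k}" "t \<in> {..<k}"
        and "(shift s (f s), f s) = (shift t (f t), f t)"
      then have "(s + f s) mod k = (t + f s) mod k" and "s < k" "t < k"
        by (auto simp: shift_def add.commute)
      then show "s = t"
        using mod_add_right_cancel_nat[of s "f s" k t] by simp
    qed
    then have "card {..<k} \<le> card F"
      using f assms(1) by (intro card_inj_on_le) auto
    then show False using assms(2) by simp
  qed
  then show ?thesis using bij by blast
qed

text \<open>The complement of \<open>A\<close> has room for a copy \<open>D\<close> of
  \<open>B\<close>. Since \<open>B\<close> and \<open>D\<close> have equally large complements, a
  bijection from \<open>B\<close> to \<open>D\<close> extends to all of \<open>N\<close>.\<close>

lemma ex_permutation_avoiding_sets:
  assumes "finite N" "A \<subseteq> N" "B \<subseteq> N" "card A + card B \<le> card N"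
  shows "\<exists>\<pi>. bij_betw \<pi> N N \<and> \<pi> ` B \<inter> A = {}"
proof -
  have fin: "finite A" "finite B" using assms finite_subset by auto
  have "card B \<le> card (N - A)"
    using assms fin by (simp add: card_Diff_subset)
  then obtain D where D: "D \<subseteq> N - A" "card D = card B" "finite D"
    by (metis obtain_subset_with_card_n)
  obtain f where f: "bij_betw f B D"
    using D fin finite_same_card_bij by metis
  have "card (N - B) = card (N - D)"
    using assms fin D by (simp add: card_Diff_subset subset_iff)
  then obtain g where g: "bij_betw g (N - B) (N - D)"
    using assms(1) finite_same_card_bij by blast
  define \<pi> where "\<pi> j = (if j \<in> B then f j else g j)" for j
  have "bij_betw \<pi> B D" "bij_betw \<pi> (N - B) (N - D)"
    using f g bij_betw_cong[of B f \<pi> D] bij_betw_cong[of "N - B" g \<pi> "N - D"]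
    by (simp_all add: \<pi>_def)
  then have "bij_betw \<pi> (B \<union> (N - B)) (D \<union> (N - D))" and im: "\<pi> ` B = D"
    by (auto intro!: bij_betw_combine simp: bij_betw_imp_surj_on simp del: Un_Diff_cancel)
  moreover have "B \<union> (N - B) = N" "D \<union> (N - D) = N" using assms D by auto
  ultimately have "bij_betw \<pi> N N" by simp
  moreover have "\<pi> ` B \<inter> A = {}" using im D(1) by blast
  ultimately show ?thesis by blast
qed

section \<open>Perfect matchings and permutations\<close>

text \<open>The empty matching exists and sizes are bounded by the number of edges. This guarantees
  that the algorithm has a run.\<close>

lemma ex_maximum_matching:
  assumes "finite (edges G)"
  shows "\<exists>M. maximum_matching G M"
proof -
  have "matching G {}" by (simp add: matching_def)
  moreover have "\<forall>M. matching G M \<longrightarrow> card M < Suc (card (edges G))"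
    using assms by (auto simp: matching_def less_Suc_eq_le intro: card_mono)
  ultimately show ?thesis
    using ex_has_greatest_nat[of "matching G" "{}" card]
    by (auto simp: maximum_matching_def is_arg_max_linorder)
qed

text \<open>Injectivity of \<open>\<pi>\<close> separates the left ends of the edges. Such a
  matching forces every maximum matching to have at least \<open>k\<close> edges.\<close>

lemma matching_of_permutation:
  assumes bij: "bij_betw \<pi> {1..k} {1..k}"
    and "\<And>j. j \<in> {1..k} \<Longrightarrow> {(\<pi> j, L), (j, R)} \<in> edges G"
  shows "\<exists>M. matching G M \<and> card M = k"
proof -
  define m where "m j = {(\<pi> j, L), (j, R)}" for j
  have "inj_on m {1..k}"
    by (auto simp: inj_on_def m_def doubleton_eq_iff)
  then have "card (m ` {1..k}) = k"
    by (simp add: card_image)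
  moreover have "disjnt (m i) (m j)" if "i \<in> {1..k}" "j \<in> {1..k}" "m i \<noteq> m j" for i j
  proof -
    have "\<pi> i \<noteq> \<pi> j" using that inj_onD[OF bij_betw_imp_inj_on[OF bij]] by metis
    then show ?thesis using that(3) by (auto simp: m_def disjnt_def)
  qed
  then have "matching G (m ` {1..k})"
    using assms(2) by (fastforce simp: matching_def pairwise_def m_def)
  ultimately show ?thesis by blast
qed

text \<open>Distinct edges have distinct right ends, so \<open>k\<close> edges cover all
  \<open>k\<close> right vertices and each colour has exactly one partner. Disjointness at the left
  ends gives injectivity, and the complement contains no edge of \<open>B\<close>.\<close>

lemma permutation_of_matching:
  assumes M: "matching (bipartite_complement ({1..k} \<times> {L}) ({1..k} \<times> {R}) B) M"
    and card: "k \<le> card M"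
  shows "bij_betw (matching_colour M) {1..k} {1..k}"
    and "j \<in> {1..k} \<Longrightarrow> {(matching_colour M j, L), (j, R)} \<notin> edges B"
proof -
  have edge: "\<exists>i\<in>{1..k}. \<exists>j\<in>{1..k}. e = {(i, L), (j, R)} \<and> e \<notin> edges B" if "e \<in> M" for e
    using M that by (fastforce simp: matching_def bipartite_complement_def)
  have disj: "e = e'" if "e \<in> M" "e' \<in> M" "v \<in> e" "v \<in> e'" for e e' v
    using M that by (metis matching_def pairwiseD disjnt_iff)
  have "\<forall>e\<in>M. \<exists>j. j \<in> {1..k} \<and> (j, R) \<in> e"
    using edge by blast
  \<comment> \<open>\<open>r\<close> sends a matching edge to the colour of its right end.\<close>
  then obtain r where r: "\<And>e. e \<in> M \<Longrightarrow> r e \<in> {1..k} \<and> (r e, R) \<in> e"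
    by metis
  have "inj_on r M"
    using r disj by (metis inj_onI)
  then have "card (r ` M) = card M" by (rule card_image)
  moreover have "r ` M \<subseteq> {1..k}" using r by auto
  ultimately have "r ` M = {1..k}"
    using card by (metis card_atLeastAtMost card_seteq diff_Suc_1 finite_atLeastAtMost)
  then have "\<exists>i. {(i, L), (j, R)} \<in> M" if "j \<in> {1..k}" for j
  proof -
    from that have "j \<in> r ` M" using \<open>r ` M = {1..k}\<close> by simp
    then obtain e where e: "e \<in> M" "r e = j" by blast
    then have "(j, R) \<in> e" using r by blast
    with edge[OF e(1)] have "\<exists>i. e = {(i, L), (j, R)}" by auto
    then show ?thesis using e(1) by blast
  qed
  moreover have "i = i'" if "{(i, L), (j, R)} \<in> M" "{(i', L), (j, R)} \<in> M" for i i' j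
    using disj[OF that, of "(j, R)"] by (auto simp: doubleton_eq_iff)
  \<comment> \<open>Unique existence is what gives the \<open>THE\<close> in
    \<open>matching_colour\<close> its meaning.\<close>
  ultimately have ex1: "\<exists>!i. {(i, L), (j, R)} \<in> M" if "j \<in> {1..k}" for j
    using that by blast
  have in_M: "{(matching_colour M j, L), (j, R)} \<in> M" if "j \<in> {1..k}" for j
    unfolding matching_colour_def using theI'[OF ex1[OF that]] .
  have "inj_on (matching_colour M) {1..k}"
  proof (rule inj_onI)
    fix i j assume ij: "i \<in> {1..k}" "j \<in> {1..k}" "matching_colour M i = matching_colour M j"
    show "i = j"
      using disj[OF in_M[OF ij(1)] in_M[OF ij(2)], of "(matching_colour M i, L)"] ij(3)
      by (auto simp: doubleton_eq_iff)
  qed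
  moreover have "matching_colour M ` {1..k} \<subseteq> {1..k}"
  proof
    fix i assume "i \<in> matching_colour M ` {1..k}"
    then obtain j where "{(i, L), (j, R)} \<in> M" using in_M by blast
    from edge[OF this] show "i \<in> {1..k}" by (auto simp: doubleton_eq_iff)
  qed
  ultimately show "bij_betw (matching_colour M) {1..k} {1..k}"
    by (simp add: bij_betw_def endo_inj_surj)
  show "{(matching_colour M j, L), (j, R)} \<notin> edges B" if "j \<in> {1..k}"
    using edge[OF in_M[OF that]] by blast
qed

section \<open>Splitting a graph along a cut set\<close>

lemma k_partition_range: "k_partition k A p \<Longrightarrow> p x = Some i \<Longrightarrow> i \<in> {1..k}"
  unfolding k_partition_def by (blast intro: ranI)

lemma k_partition_obtain:
  assumes "k_partition k A p" "x \<in> A"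
  obtains i where "p x = Some i" "i \<in> {1..k}"
  using assms k_partition_range[OF assms(1)] unfolding k_partition_def by blast

lemma equiv_connected_rel: "equiv (verts G) (connected_rel G)"
proof (rule equivI)
  have "sym {(u, v). {u, v} \<in> edges G}"
    by (auto simp: sym_def insert_commute)
  then have "sym ({(u, v). {u, v} \<in> edges G}\<^sup>*)"
    by (rule sym_rtrancl)
  then show "sym (connected_rel G)"
    unfolding connected_rel_def by (auto intro: symI dest: symD)
  show "trans (connected_rel G)"
    unfolding connected_rel_def by (auto intro!: transI elim: rtrancl_trans)
qed (auto simp: refl_on_def connected_rel_def)

text \<open>Every edge leaving or entering \<open>S\<close> has been deleted, so no step of a path
  changes membership in \<open>S\<close>.\<close>

lemma connected_rel_delete_cut:
  assumes "(x, y) \<in> connected_rel (delete_edges G (cut G S))"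
  shows "x \<in> S \<longleftrightarrow> y \<in> S"
proof -
  have "(x, y) \<in> {(u, v). {u, v} \<in> edges (delete_edges G (cut G S))}\<^sup>*"
    using assms by (simp add: connected_rel_def)
  then show ?thesis
  proof (induction rule: rtrancl_induct)
    case (step y z)
    then have "{y, z} \<in> edges G" "{y, z} \<notin> cut G S"
      by (auto simp: delete_edges_def)
    then have "y \<in> S \<longleftrightarrow> z \<in> S"
      unfolding cut_def by (auto simp: insert_commute)
    then show ?case using step.IH by blast
  qed simp
qed

section \<open>Edge sets and weights of partitions\<close>

lemma finite_edges: "simple_graph G \<Longrightarrow> finite (edges G)"
  by (rule finite_subset[of _ "Pow (verts G)"]) (auto simp: simple_graph_def)

definition cut_edges :: "('a, 'b) graph_scheme \<Rightarrow> ('a \<rightharpoonup> nat) \<Rightarrow> 'a set set" where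
  "cut_edges G p = {e \<in> edges G. \<exists>x y. e = {x, y} \<and> p x \<noteq> p y}"

lemma partition_weight_cut_edges: "partition_weight G p = sum (weight G) (cut_edges G p)"
  by (simp add: partition_weight_def cut_edges_def)

text \<open>The weight depends only on which adjacent vertices share a colour. This covers both
  restricting a partition and permuting its colours.\<close>

lemma partition_weight_cong:
  assumes "\<And>x y. {x, y} \<in> edges G \<Longrightarrow> p x = p y \<longleftrightarrow> q x = q y"
  shows "partition_weight G p = partition_weight G q"
proof -
  have "cut_edges G p = cut_edges G q"
    using assms unfolding cut_edges_def by blast
  then show ?thesis by (simp add: partition_weight_cut_edges)
qed

text \<open>The set equation \<open>comps\<close> would also hold for a single component with
  \<open>G1 = G2\<close>; \<open>distinct\<close> makes the number of components exactly
  two.\<close>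

locale two_component_cut =
  fixes G G1 G2 :: "'a wgraph" and C :: "'a set set"
  assumes simple: "simple_graph G"
    and positive: "positive_cut_set G C"
    and comps: "components (delete_edges G C) = {G1, G2}"
    and distinct: "G1 \<noteq> G2"
begin

section \<open>The two components and the edges between them\<close>

lemma G1_in_components: "\<exists>V \<in> component_verts (delete_edges G C).
    G1 = induced_subgraph (delete_edges G C) V"
  and G2_in_components: "\<exists>V \<in> component_verts (delete_edges G C).
    G2 = induced_subgraph (delete_edges G C) V"
  using comps by (auto simp: components_def)

lemma G1_eq: "G1 = induced_subgraph (delete_edges G C) (verts G1)"
  and G2_eq: "G2 = induced_subgraph (delete_edges G C) (verts G2)"
  using G1_in_components G2_in_components by (auto simp: induced_subgraph_def)

lemma weight_components: "weight G1 = weight G" "weight G2 = weight G"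
  using G1_in_components G2_in_components by (auto simp: induced_subgraph_def delete_edges_def)

lemma edges_components:
  "edges G1 = {e \<in> edges G - C. e \<subseteq> verts G1}" "edges G2 = {e \<in> edges G - C. e \<subseteq> verts G2}"
  using G1_in_components G2_in_components by (auto simp: induced_subgraph_def delete_edges_def)

lemma component_verts_eq: "component_verts (delete_edges G C) = {verts G1, verts G2}"
proof -
  have "component_verts (delete_edges G C) = verts ` components (delete_edges G C)"
    by (force simp: components_def induced_subgraph_def)
  then show ?thesis using comps by simp
qed

text \<open>An induced subgraph is determined by its vertex set.\<close>

lemma verts_distinct: "verts G1 \<noteq> verts G2"
proof
  assume "verts G1 = verts G2"
  then have "induced_subgraph (delete_edges G C) (verts G1) = induced_subgraph (delete_edges G C) (verts G2)"
    by (rule arg_cong)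
  then show False using distinct by (simp only: G1_eq[symmetric] G2_eq[symmetric])
qed

lemma verts_Un: "verts G = verts G1 \<union> verts G2"
  using Union_quotient[OF equiv_connected_rel[of "delete_edges G C"]] component_verts_eq
  by (simp add: component_verts_def delete_edges_def)

lemma verts_Int: "verts G1 \<inter> verts G2 = {}"
  using quotient_disj[OF equiv_connected_rel[of "delete_edges G C"], of "verts G1" "verts G2"]
    component_verts_eq verts_distinct
  by (simp add: component_verts_def)

lemma connected_in_component:
  assumes "V \<in> {verts G1, verts G2}" "x \<in> V" "y \<in> V"
  shows "(x, y) \<in> connected_rel (delete_edges G C)"
  using assms component_verts_eq
    quotient_eq_iff[OF equiv_connected_rel[of "delete_edges G C"], of V V x y]
  unfolding component_verts_def by auto

lemma adjacent_in_component:
  assumes "{x, y} \<in> edges G - C"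
  shows "x \<in> verts G1 \<longleftrightarrow> y \<in> verts G1"
proof -
  let ?r = "connected_rel (delete_edges G C)"
  have "(x, y) \<in> ?r"
    using assms simple by (auto simp: connected_rel_def delete_edges_def simple_graph_def)
  moreover have "verts G1 \<in> verts (delete_edges G C) // ?r"
    using component_verts_eq by (auto simp: component_verts_def)
  ultimately show ?thesis
    using equiv_connected_rel[of "delete_edges G C"]
    by (metis in_quotient_imp_closed equiv_def symD)
qed

text \<open>The set \<open>S\<close> defining the cut separates the ends of \<open>e\<close>, so no
  path avoiding \<open>C\<close> joins them. They lie in different components, of which there are
  only two.\<close>

lemma cut_edgeE:
  assumes "e \<in> C"
  obtains x y where "x \<in> verts G1" "y \<in> verts G2" "e = {x, y}"
proof -
  obtain S where S: "C = cut G S"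
    using positive by (auto simp: positive_cut_set_def cut_set_def)
  obtain s t where st: "e = {s, t}" "{s, t} \<in> edges G" "s \<in> S" "t \<notin> S"
    using assms S by (auto simp: cut_def)
  have V: "s \<in> verts G1 \<union> verts G2" "t \<in> verts G1 \<union> verts G2"
    using st(2) simple verts_Un by (auto simp: simple_graph_def)
  have "(s, t) \<notin> connected_rel (delete_edges G C)"
    using connected_rel_delete_cut S st by metis
  then have "s \<in> verts G1 \<and> t \<in> verts G2 \<or> t \<in> verts G1 \<and> s \<in> verts G2"
    using V connected_in_component by blast
  then show ?thesis using that st(1) by (metis insert_commute)
qed

lemma C_subset: "C \<subseteq> edges G"
  using positive by (auto simp: positive_cut_set_def cut_set_def cut_def)

lemma finite_C: "finite C"
  using C_subset finite_edges[OF simple] by (rule finite_subset)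

lemma edges_Un: "edges G = edges G1 \<union> edges G2 \<union> C"
proof
  show "edges G \<subseteq> edges G1 \<union> edges G2 \<union> C"
  proof
    fix e assume e: "e \<in> edges G"
    then obtain x y where xy: "e = {x, y}"
      using simple by (auto simp: simple_graph_def card_2_iff)
    have "{x, y} \<subseteq> verts G1 \<union> verts G2"
      using e xy simple verts_Un by (auto simp: simple_graph_def)
    then show "e \<in> edges G1 \<union> edges G2 \<union> C"
      using e xy adjacent_in_component[of x y] by (auto simp: edges_components)
  qed
qed (use C_subset edges_components in auto)

text \<open>A common edge of both components would be contained in the empty intersection of their
  vertex sets, but edges have two elements.\<close>

lemma edges_disjoint: "edges G1 \<inter> edges G2 = {}" "(edges G1 \<union> edges G2) \<inter> C = {}"
proof -
  have "e = {}" if "e \<in> edges G1" "e \<in> edges G2" for e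
    using that verts_Int edges_components by blast
  moreover have "{} \<notin> edges G1"
    using simple edges_components by (auto simp: simple_graph_def)
  ultimately show "edges G1 \<inter> edges G2 = {}" by blast
qed (auto simp: edges_components)

lemma simple_components: "simple_graph G1" "simple_graph G2"
  using simple verts_Un by (auto simp: simple_graph_def edges_components)

section \<open>Weights and optimality across the split\<close>

lemma partition_weight_split:
  "partition_weight G p = partition_weight G1 p + partition_weight G2 p
     + sum (weight G) {e \<in> C. \<exists>x y. e = {x, y} \<and> p x \<noteq> p y}"
proof -
  have "cut_edges G p = (cut_edges G1 p \<union> cut_edges G2 p) \<union> {e \<in> C. \<exists>x y. e = {x, y} \<and> p x \<noteq> p y}"
    by (auto simp: cut_edges_def edges_Un)
  moreover have "finite (cut_edges G1 p)" "finite (cut_edges G2 p)"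
    using simple_components[THEN finite_edges] by (simp_all add: cut_edges_def)
  ultimately show ?thesis
    unfolding partition_weight_cut_edges weight_components
    using edges_disjoint finite_C
    by (simp add: sum.union_disjoint cut_edges_def disjoint_iff)
qed

text \<open>A partition of \<open>G\<close> has too large a domain to compete on a component, so it
  must be restricted before optimality there applies.\<close>

lemma partition_weight_restrict:
  "partition_weight G1 (p |` verts G1) = partition_weight G1 p"
  "partition_weight G2 (p |` verts G2) = partition_weight G2 p"
  by (rule partition_weight_cong, simp add: edges_components)+

text \<open>The weight of a competitor \<open>q\<close> has three parts: two are bounded by the
  optima on the components, the third by the total weight of \<open>C\<close>. The partition
  \<open>p\<close> attains all three bounds.\<close>

lemma optimum_glue:
  assumes opt1: "optimum_max_k_cut k G1 p'" and opt2: "optimum_max_k_cut k G2 p''"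
    and p: "k_partition k (verts G) p"
    and w1: "partition_weight G1 p = partition_weight G1 p'"
    and w2: "partition_weight G2 p = partition_weight G2 p''"
    and cut: "\<And>x y. {x, y} \<in> C \<Longrightarrow> x \<in> verts G1 \<Longrightarrow> y \<in> verts G2 \<Longrightarrow> p x \<noteq> p y"
  shows "optimum_max_k_cut k G p"
  unfolding optimum_max_k_cut_def is_arg_max_linorder
proof (intro conjI allI impI p)
  fix q :: "'a \<rightharpoonup> nat" assume q: "k_partition k (verts G) q"
  then have "k_partition k (verts G1) (q |` verts G1)" "k_partition k (verts G2) (q |` verts G2)"
    using verts_Un by (auto simp: k_partition_def ran_def restrict_map_def subset_iff dom_def
        split: if_splits)
  then have "partition_weight G1 q \<le> partition_weight G1 p'"
    "partition_weight G2 q \<le> partition_weight G2 p''"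
    using opt1 opt2 partition_weight_restrict
    by (auto simp: optimum_max_k_cut_def is_arg_max_linorder)
  \<comment> \<open>Positivity of the weights on \<open>C\<close> enters here: a partial sum does
    not exceed the full one.\<close>
  moreover have "sum (weight G) {e \<in> C. \<exists>x y. e = {x, y} \<and> q x \<noteq> q y} \<le> sum (weight G) C"
    using positive finite_C by (intro sum_mono2) (auto simp: positive_cut_set_def less_imp_le)
  moreover have "{e \<in> C. \<exists>x y. e = {x, y} \<and> p x \<noteq> p y} = C"
    using cut by (blast elim: cut_edgeE)
  ultimately show "partition_weight G q \<le> partition_weight G p"
    unfolding partition_weight_split[of p] partition_weight_split[of q] w1 w2 by simp
qed

section \<open>Success of the reconstruction\<close>

lemma ex_colour_permutation:
  assumes "k \<ge> 1" and p': "k_partition k (verts G1) p'" and p'': "k_partition k (verts G2) p''"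
    and small: "card (\<Union>C) \<le> k \<or> card C \<le> k - 1"
  shows "\<exists>\<pi>. bij_betw \<pi> {1..k} {1..k} \<and>
    (\<forall>x\<in>verts G1. \<forall>y\<in>verts G2. \<forall>j. {x, y} \<in> C \<longrightarrow> p'' y = Some j \<longrightarrow> p' x \<noteq> Some (\<pi> j))"
  using small
proof
  assume few: "card (\<Union>C) \<le> k"
  let ?U1 = "\<Union>C \<inter> verts G1" and ?U2 = "\<Union>C \<inter> verts G2"
  \<comment> \<open>These are the colours at the ends of cut edges on either side;
    \<open>the\<close> is safe because the ends lie in the domains.\<close>
  let ?A = "(the \<circ> p') ` ?U1" and ?B = "(the \<circ> p'') ` ?U2"
  have fin: "finite ?U1" "finite ?U2"
    using simple_components by (auto simp: simple_graph_def)
  have "\<Union>C \<subseteq> verts G1 \<union> verts G2"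
    using C_subset simple unfolding verts_Un[symmetric] simple_graph_def by blast
  then have "\<Union>C = ?U1 \<union> ?U2" by blast
  moreover have "card (?U1 \<union> ?U2) = card ?U1 + card ?U2"
    using fin verts_Int by (intro card_Un_disjoint) blast+
  ultimately have "card ?U1 + card ?U2 = card (\<Union>C)" by simp
  then have "card ?A + card ?B \<le> card {1..k}"
    using few card_image_le[OF fin(1), of "the \<circ> p'"] card_image_le[OF fin(2), of "the \<circ> p''"]
    by simp
  moreover have "?A \<subseteq> {1..k}" "?B \<subseteq> {1..k}"
  proof -
    show "?A \<subseteq> {1..k}"
    proof
      fix i assume "i \<in> ?A"
      then obtain x where "x \<in> verts G1" "i = the (p' x)" by auto
      then show "i \<in> {1..k}" by (auto elim: k_partition_obtain[OF p'])
    qed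
    show "?B \<subseteq> {1..k}"
    proof
      fix j assume "j \<in> ?B"
      then obtain y where "y \<in> verts G2" "j = the (p'' y)" by auto
      then show "j \<in> {1..k}" by (auto elim: k_partition_obtain[OF p''])
    qed
  qed
  ultimately obtain \<pi> where \<pi>: "bij_betw \<pi> {1..k} {1..k}" "\<pi> ` ?B \<inter> ?A = {}"
    using ex_permutation_avoiding_sets[of "{1..k}" ?A ?B] by (meson finite_atLeastAtMost)
  have "p' x \<noteq> Some (\<pi> j)"
    if "x \<in> verts G1" "y \<in> verts G2" "{x, y} \<in> C" "p'' y = Some j" for x y j
  proof
    assume "p' x = Some (\<pi> j)"
    then have "(the \<circ> p') x = \<pi> j" "(the \<circ> p'') y = j" "x \<in> ?U1" "y \<in> ?U2"
      using that by auto
    then have "\<pi> j \<in> ?A" "j \<in> ?B" by (metis imageI)+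
    then show False using \<pi>(2) by blast
  qed
  then show ?thesis using \<pi>(1) by blast
next
  assume few: "card C \<le> k - 1"
  define F where "F = {(i, j). \<exists>x\<in>verts G1. \<exists>y\<in>verts G2. {x, y} \<in> C \<and> p' x = Some i \<and> p'' y = Some j}"
  \<comment> \<open>\<open>f\<close> reads the conflicting colour pair off a cut edge. Each such
    edge has exactly one end in each component, so both \<open>THE\<close> terms are determined and
    \<open>F\<close> is no larger than \<open>C\<close>.\<close>
  define f where "f e = (the (p' (THE x. x \<in> e \<inter> verts G1)), the (p'' (THE y. y \<in> e \<inter> verts G2)))" for e
  have "F \<subseteq> f ` C"
  proof
    fix c assume "c \<in> F"
    then obtain x y i j where xy: "x \<in> verts G1" "y \<in> verts G2" "{x, y} \<in> C"
      and c: "c = (i, j)" "p' x = Some i" "p'' y = Some j"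
      by (auto simp: F_def)
    have "{x, y} \<inter> verts G1 = {x}" "{x, y} \<inter> verts G2 = {y}"
      using xy verts_Int by auto
    then have "f {x, y} = c" unfolding f_def by (simp add: c del: Int_insert_left)
    then show "c \<in> f ` C" using xy(3) by blast
  qed
  then have "finite F" "card F \<le> card C"
    using finite_surj[OF finite_C] surj_card_le[OF finite_C] by simp_all
  \<comment> \<open>Since \<open>k - 1\<close> is truncated subtraction, strictness relies on
    \<open>k \<ge> 1\<close>.\<close>
  moreover from this have "card F < k" using few \<open>k \<ge> 1\<close> by linarith
  ultimately obtain \<pi> where \<pi>: "bij_betw \<pi> {1..k} {1..k}" "\<forall>j\<in>{1..k}. (\<pi> j, j) \<notin> F"
    using ex_permutation_avoiding_pairs by meson
  show ?thesis
  proof (rule exI[of _ \<pi>], intro conjI ballI allI impI notI)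
    show "bij_betw \<pi> {1..k} {1..k}" by (fact \<pi>(1))
  next
    fix x y j
    assume "x \<in> verts G1" "y \<in> verts G2" "{x, y} \<in> C" "p'' y = Some j" "p' x = Some (\<pi> j)"
    then have "(\<pi> j, j) \<in> F" unfolding F_def by blast
    then show False using \<pi>(2) k_partition_range[OF p'' \<open>p'' y = Some j\<close>] by blast
  qed
qed

text \<open>A conflict-free permutation yields a matching of size \<open>k\<close>, so a maximum
  matching never triggers the error. Conversely, the colouring read off any such matching avoids all
  conflicts.\<close>

lemma reconstruct_SCS_runs:
  assumes "k \<ge> 1" and p': "k_partition k (verts G1) p'" and p'': "k_partition k (verts G2) p''"
    and small: "card (\<Union>C) \<le> k \<or> card C \<le> k - 1"
  shows "reconstruct_SCS G C p' p'' k \<noteq> {}"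
    and "r \<in> reconstruct_SCS G C p' p'' k \<Longrightarrow>
      \<exists>p \<pi>. r = Return p \<and> bij_betw \<pi> {1..k} {1..k} \<and> k_partition k (verts G) p \<and>
        (\<forall>x\<in>verts G1. p x = p' x) \<and> (\<forall>y\<in>verts G2. p y = map_option \<pi> (p'' y)) \<and>
        (\<forall>x\<in>verts G1. \<forall>y\<in>verts G2. {x, y} \<in> C \<longrightarrow> p x \<noteq> p y)"
proof -
  define H where "H = colour_relation_graph C (verts G1) (verts G2) p' p'' k"
  define B where "B = bipartite_complement ({1..k} \<times> {L}) ({1..k} \<times> {R}) H"
  have dom: "dom p' = verts G1" "dom p'' = verts G2"
    using p' p'' by (auto simp: k_partition_def)
  have ran: "i \<in> {1..k}" if "p' x = Some i \<or> p'' x = Some i" for x i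
    using that k_partition_range[OF p'] k_partition_range[OF p''] by blast
  have H_edge: "{(i, L), (j, R)} \<in> edges H \<longleftrightarrow>
      (\<exists>x\<in>verts G1. \<exists>y\<in>verts G2. {x, y} \<in> C \<and> p' x = Some i \<and> p'' y = Some j)" for i j
    by (auto simp: H_def colour_relation_graph_def doubleton_eq_iff)
  have "edges B \<subseteq> (\<lambda>(x, y). {x, y}) ` (({1..k} \<times> {L}) \<times> ({1..k} \<times> {R}))"
    by (auto simp: B_def bipartite_complement_def)
  then have "finite (edges B)" by (rule finite_subset) auto
  then obtain M where "maximum_matching B M" using ex_maximum_matching by blast
  then show "reconstruct_SCS G C p' p'' k \<noteq> {}"
    using verts_distinct component_verts_eq dom
    unfolding reconstruct_SCS_def B_def H_def by blast
  \<comment> \<open>\<open>\<sigma>\<close> only witnesses that a matching of size \<open>k\<close>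
    exists; the permutation used by a run comes from its own matching \<open>M\<close> and may
    differ.\<close>
  obtain \<sigma> where \<sigma>: "bij_betw \<sigma> {1..k} {1..k}"
    "\<And>x y j. \<lbrakk>x \<in> verts G1; y \<in> verts G2; {x, y} \<in> C; p'' y = Some j\<rbrakk> \<Longrightarrow> p' x \<noteq> Some (\<sigma> j)"
    using ex_colour_permutation[OF assms] by blast
  have "{(\<sigma> j, L), (j, R)} \<in> edges B" if "j \<in> {1..k}" for j
  proof -
    have "{(\<sigma> j, L), (j, R)} \<notin> edges H" using \<sigma>(2) by (auto simp: H_edge)
    moreover have "\<sigma> j \<in> {1..k}" using \<sigma>(1) that bij_betwE by blast
    ultimately show ?thesis using that by (auto simp: B_def bipartite_complement_def)
  qed
  then obtain M0 where M0: "matching B M0" "card M0 = k"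
    using matching_of_permutation[OF \<sigma>(1)] by blast
  assume "r \<in> reconstruct_SCS G C p' p'' k"
  then obtain V1 V2 M where V: "dom p' = V1" "dom p'' = V2"
    and M: "maximum_matching
      (bipartite_complement ({1..k} \<times> {L}) ({1..k} \<times> {R}) (colour_relation_graph C V1 V2 p' p'' k)) M"
    and r: "r = (if card M < k then Error
      else Return (\<lambda>v. if v \<in> V1 then p' v
        else if v \<in> V2 then map_option (matching_colour M) (p'' v) else None))"
    unfolding reconstruct_SCS_def by blast
  \<comment> \<open>The domains of the input partitions fix which component plays which
    role.\<close>
  have V_eq: "V1 = verts G1" "V2 = verts G2" using V dom by auto
  have "maximum_matching B M" using M by (simp add: V_eq B_def H_def)
  then have M': "matching B M" "k \<le> card M"
    using M0 by (auto simp: maximum_matching_def is_arg_max_linorder)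
  define \<pi> where "\<pi> = matching_colour M"
  have \<pi>: "bij_betw \<pi> {1..k} {1..k}" "\<And>j. j \<in> {1..k} \<Longrightarrow> {(\<pi> j, L), (j, R)} \<notin> edges H"
    using permutation_of_matching M' unfolding B_def \<pi>_def by blast+
  define p where "p v = (if v \<in> verts G1 then p' v
    else if v \<in> verts G2 then map_option \<pi> (p'' v) else None)" for v
  have "r = Return p" using r M' by (auto simp: p_def \<pi>_def V_eq)
  moreover have on1: "\<forall>x\<in>verts G1. p x = p' x" by (simp add: p_def)
  moreover have on2: "\<forall>y\<in>verts G2. p y = map_option \<pi> (p'' y)"
    using verts_Int by (auto simp: p_def)
  moreover have "k_partition k (verts G) p"
  proof -
    have "dom p = verts G"
      using dom by (auto simp: p_def verts_Un dom_def split: if_splits)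
    moreover have "ran p \<subseteq> {1..k}"
    proof
      fix i assume "i \<in> ran p"
      then obtain v where v: "p v = Some i" by (auto simp: ran_def)
      show "i \<in> {1..k}"
      proof (cases "v \<in> verts G1")
        case True
        then show ?thesis using v ran[of v i] by (simp add: p_def)
      next
        case False
        then obtain j where "p'' v = Some j" "i = \<pi> j"
          using v by (auto simp: p_def split: if_splits)
        then show ?thesis using ran \<pi>(1) bij_betwE by blast
      qed
    qed
    ultimately show ?thesis by (simp add: k_partition_def)
  qed
  moreover have "p x \<noteq> p y" if xy: "x \<in> verts G1" "y \<in> verts G2" "{x, y} \<in> C" for x y
  proof
    assume eq: "p x = p y"
    obtain j where j: "p'' y = Some j" using xy(2) dom by blast
    have "p' x = Some (\<pi> j)" using eq on1 on2 xy j by simp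
    \<comment> \<open>A cut edge with equally coloured ends would put a matching edge into the
      colour relation graph, whereas \<open>M\<close> lies in its complement.\<close>
    then have "{(\<pi> j, L), (j, R)} \<in> edges H" using xy j H_edge by blast
    then show False using \<pi>(2) ran j by blast
  qed
  ultimately show "\<exists>p \<pi>. r = Return p \<and> bij_betw \<pi> {1..k} {1..k} \<and> k_partition k (verts G) p \<and>
        (\<forall>x\<in>verts G1. p x = p' x) \<and> (\<forall>y\<in>verts G2. p y = map_option \<pi> (p'' y)) \<and>
        (\<forall>x\<in>verts G1. \<forall>y\<in>verts G2. {x, y} \<in> C \<longrightarrow> p x \<noteq> p y)"
    using \<pi>(1) by blast
qed

text \<open>The output agrees with \<open>p'\<close> on the first component and is a recolouring of
  \<open>p''\<close> by a permutation on the second, so both component weights stay optimal and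
  \<open>optimum_glue\<close> applies.\<close>

lemma reconstruct_SCS_optimum:
  assumes "k \<ge> 1" and opt1: "optimum_max_k_cut k G1 p'" and opt2: "optimum_max_k_cut k G2 p''"
    and small: "card (\<Union>C) \<le> k \<or> card C \<le> k - 1"
    and r: "r \<in> reconstruct_SCS G C p' p'' k"
  shows "\<exists>p. r = Return p \<and> optimum_max_k_cut k G p"
proof -
  have parts: "k_partition k (verts G1) p'" "k_partition k (verts G2) p''"
    using opt1 opt2 by (auto simp: optimum_max_k_cut_def is_arg_max_def)
  obtain p \<pi> where p: "r = Return p" "k_partition k (verts G) p"
    and \<pi>: "bij_betw \<pi> {1..k} {1..k}"
    and on1: "\<forall>x\<in>verts G1. p x = p' x" and on2: "\<forall>y\<in>verts G2. p y = map_option \<pi> (p'' y)"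
    and cut: "\<forall>x\<in>verts G1. \<forall>y\<in>verts G2. {x, y} \<in> C \<longrightarrow> p x \<noteq> p y"
    using reconstruct_SCS_runs(2)[OF \<open>k \<ge> 1\<close> parts small r] by blast
  have "partition_weight G1 p = partition_weight G1 p'"
    using on1 by (intro partition_weight_cong) (auto simp: edges_components)
  moreover have "partition_weight G2 p = partition_weight G2 p''"
  proof (rule partition_weight_cong)
    fix x y assume "{x, y} \<in> edges G2"
    then have xy: "x \<in> verts G2" "y \<in> verts G2"
      by (auto simp: edges_components)
    obtain i where i: "p'' x = Some i" "i \<in> {1..k}"
      using k_partition_obtain[OF parts(2) xy(1)] .
    obtain j where j: "p'' y = Some j" "j \<in> {1..k}"
      using k_partition_obtain[OF parts(2) xy(2)] .
    \<comment> \<open>Injectivity is available only on \<open>{1..k}\<close>, hence the range facts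
      for \<open>i\<close> and \<open>j\<close>.\<close>
    have "\<pi> i = \<pi> j \<longleftrightarrow> i = j"
      by (rule inj_on_eq_iff[OF bij_betw_imp_inj_on[OF \<pi>] i(2) j(2)])
    then show "p x = p y \<longleftrightarrow> p'' x = p'' y"
      using xy on2 i(1) j(1) by simp
  qed
  ultimately have "optimum_max_k_cut k G p"
    using optimum_glue[OF opt1 opt2 p(2)] cut by blast
  then show ?thesis using p(1) by blast
qed

end

theorem theorem16:
  fixes k :: nat and G G1 G2 :: "'a wgraph" and C :: "'a set set"
  assumes "k \<ge> 1"
    and "simple_graph G"
    and "positive_cut_set G C"
    and "components (delete_edges G C) = {G1, G2}" and "G1 \<noteq> G2"
    and "card (verts (edge_subgraph G C)) \<le> k \<or> card (edges (edge_subgraph G C)) \<le> k - 1"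
  shows "data_separation k G [G1, G2] (\<lambda>ps. reconstruct_SCS G C (ps ! 0) (ps ! 1) k)
    \<and> optimality_preserving k G [G1, G2] (\<lambda>ps. reconstruct_SCS G C (ps ! 0) (ps ! 1) k)"
proof -
  interpret two_component_cut G G1 G2 C
    by unfold_locales (use assms in auto)
  have small: "card (\<Union>C) \<le> k \<or> card C \<le> k - 1"
    using assms(6) by (simp add: edge_subgraph_def)
  let ?rec = "\<lambda>ps. reconstruct_SCS G C (ps ! 0) (ps ! 1) k"
  \<comment> \<open>Kept general in \<open>P\<close> to serve both arbitrary and optimum
    partitions.\<close>
  have pair: "\<exists>p' p''. ps = [p', p''] \<and> P G1 p' \<and> P G2 p''"
    if "list_all2 P [G1, G2] ps" for P :: "'a wgraph \<Rightarrow> ('a \<rightharpoonup> nat) \<Rightarrow> bool" and ps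
    using that by (auto simp: list_all2_Cons1)
  show ?thesis
    unfolding data_separation_def optimality_preserving_def
  proof (intro conjI allI impI)
    show "\<forall>H\<in>set [G1, G2]. simple_graph H"
      using simple_components by simp
  next
    fix ps assume "list_all2 (\<lambda>H. k_partition k (verts H)) [G1, G2] ps"
    then obtain p' p'' where ps: "ps = [p', p'']"
      and parts: "k_partition k (verts G1) p'" "k_partition k (verts G2) p''"
      using pair by blast
    show "?rec ps \<noteq> {}"
      using reconstruct_SCS_runs(1)[OF assms(1) parts small] by (simp add: ps)
    show "\<forall>r\<in>?rec ps. \<exists>p. r = Return p \<and> k_partition k (verts G) p"
      using reconstruct_SCS_runs(2)[OF assms(1) parts small] unfolding ps by fastforce
  next
    fix ps assume "list_all2 (optimum_max_k_cut k) [G1, G2] ps"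
    then obtain p' p'' where ps: "ps = [p', p'']"
      and opt: "optimum_max_k_cut k G1 p'" "optimum_max_k_cut k G2 p''"
      using pair by blast
    show "\<forall>r\<in>?rec ps. \<exists>p. r = Return p \<and> optimum_max_k_cut k G p"
      using reconstruct_SCS_optimum[OF assms(1) opt small] by (simp add: ps)
  qed
qed

end
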